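(* For every election instance consisting of $k \ge 1$ offices with pairwise disjoint nonempty finite candidate sets $A_1,\dots,A_k$ and $n \ge 1$ voters with approval ballots $v_1,\dots,v_n \subseteq A = \bigcup_{j\in[k]} A_j$, there exists an office allocation $X$ satisfying Partial Proportional Justified Representation.
   Context: Setting. $[k]=\{1,\dots,k\}$. There are $k$ offices; office $j$ has a nonempty finite set $A_j$ of candidates, the sets $A_1,\dots,A_k$ are pairwise disjoint, and $A=\bigcup_{j\in[k]}A_j$. There are $n$ voters $V=\{v_1,\dots,v_n\}$; each voter $v$ is identified with her approval ballot $v\subseteq A$ (different voters may have identical ballots and are still counted separately, so $|V|=n$). An office allocation is a set $X=\{w_1,\dots,w_k\}$ with $w_j\in A_j$ for every $j\in[k]$. Definition (Partial Proportional Justified Representation). An office allocation $X$ satisfies Partial Proportional Justified Representation if for every nonempty group of voters $V'\subseteq V$ and every integer $k'$ with $1\le k'\le k$ the following holds: if there is a set $T\subseteq[k]$ with $|T|\ge k'$ such that $\left(\bigcap_{v\in V'}v\right)\cap A_j\neq\emptyset$ for all $j\in T$, and $\left\lfloor\frac{|V'|}{|V|}\,k'\right\rfloor>0$, then $\left|\left(\bigcup_{v\in V'}v\right)\cap X\right|\ge\left\lfloor\frac{|V'|}{|V|}\,k'\right\rfloor$. *)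

theory Defs
  imports Complex_Main "HOL-Library.Disjoint_Sets"
begin

text \<open>
  Offices are the indices \<open>{1..k}\<close>, with \<open>A j\<close> the candidates for office \<open>j\<close>. Voters are the
  indices \<open>{1..n}\<close>, with \<open>v i\<close> the ballot of voter \<open>i\<close>; voters with equal ballots are therefore
  counted separately.
\<close>

definition election :: "nat \<Rightarrow> (nat \<Rightarrow> 'c set) \<Rightarrow> nat \<Rightarrow> (nat \<Rightarrow> 'c set) \<Rightarrow> bool" where
  "election k A n v \<longleftrightarrow>
     k \<ge> 1 \<and> n \<ge> 1 \<and>
     (\<forall>j\<in>{1..k}. finite (A j) \<and> A j \<noteq> {}) \<and>
     disjoint_family_on A {1..k} \<and>
     (\<forall>i\<in>{1..n}. v i \<subseteq> (\<Union>j\<in>{1..k}. A j))"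

definition office_allocation :: "nat \<Rightarrow> (nat \<Rightarrow> 'c set) \<Rightarrow> 'c set \<Rightarrow> bool" where
  "office_allocation k A X \<longleftrightarrow> (\<exists>w. (\<forall>j\<in>{1..k}. w j \<in> A j) \<and> X = w ` {1..k})"

definition partial_PJR ::
  "nat \<Rightarrow> (nat \<Rightarrow> 'c set) \<Rightarrow> nat \<Rightarrow> (nat \<Rightarrow> 'c set) \<Rightarrow> 'c set \<Rightarrow> bool" where
  "partial_PJR k A n v X \<longleftrightarrow>
     (\<forall>V' k'. V' \<subseteq> {1..n} \<and> V' \<noteq> {} \<and> 1 \<le> k' \<and> k' \<le> k \<and>
        (\<exists>T\<subseteq>{1..k}. card T \<ge> k' \<and> (\<forall>j\<in>T. (\<Inter>i\<in>V'. v i) \<inter> A j \<noteq> {})) \<and>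
        \<lfloor>real (card V') / real n * real k'\<rfloor> > 0
        \<longrightarrow> int (card ((\<Union>i\<in>V'. v i) \<inter> X)) \<ge> \<lfloor>real (card V') / real n * real k'\<rfloor>)"

end

theory Submission
  imports Defs "HOL-Library.FuncSet" "HOL-Analysis.Harmonic_Numbers"
begin

text \<open>
  Choose \<open>w\<close> maximising the proportional approval voting score, in which a voter approving \<open>u\<close> of
  the winners contributes the harmonic number \<open>H\<^sub>u\<close>. Suppose a group \<open>S\<close> agrees on the offices in
  \<open>T\<close> but approves fewer than \<open>l\<close> winners, where \<open>l n \<le> |T| |S|\<close>. At least \<open>|T| - l + 1\<close> offices in
  \<open>T\<close> have a winner approved by nobody in \<open>S\<close>; replacing such a winner by a common candidate of \<open>S\<close>
  raises the contribution of each member of \<open>S\<close> by at least \<open>1/l\<close>, while a voter outside \<open>S\<close> loses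
  at most \<open>1/u\<close>, and this only for the at most \<open>u\<close> offices whose winner she approves. Adding up
  these exchanges, none of which raises the score, yields \<open>(|T| - l + 1) |S| / l \<le> n - |S|\<close>,
  contradicting \<open>l n \<le> |T| |S|\<close>.
\<close>

text \<open>Counting offices rather than winners lets the exchange lemmas work without injectivity
  of \<open>w\<close>.\<close>

definition approved_offices :: "'j set \<Rightarrow> ('j \<Rightarrow> 'c) \<Rightarrow> 'c set \<Rightarrow> nat" where
  "approved_offices J w B = card {j\<in>J. w j \<in> B}"

definition pav_score :: "'j set \<Rightarrow> 'i set \<Rightarrow> ('i \<Rightarrow> 'c set) \<Rightarrow> ('j \<Rightarrow> 'c) \<Rightarrow> real" where
  "pav_score J N v w = (\<Sum>i\<in>N. harm (approved_offices J w (v i)))"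

lemma approved_offices_remove:
  assumes "finite J" "j \<in> J"
  shows "approved_offices J w B = approved_offices (J - {j}) w B + of_bool (w j \<in> B)"
proof -
  have "{x\<in>J. w x \<in> B} = {x\<in>J - {j}. w x \<in> B} \<union> (if w j \<in> B then {j} else {})"
    using assms by auto
  then show ?thesis
    using assms by (simp add: approved_offices_def)
qed

lemma approved_offices_fun_upd:
  assumes "finite J" "j \<in> J"
  shows "approved_offices J (w(j := a)) B + of_bool (w j \<in> B) =
         approved_offices J w B + of_bool (a \<in> B)"
proof -
  have "{x\<in>J - {j}. (w(j := a)) x \<in> B} = {x\<in>J - {j}. w x \<in> B}"
    by auto
  then have "approved_offices (J - {j}) (w(j := a)) B = approved_offices (J - {j}) w B"
    by (simp add: approved_offices_def)
  then show ?thesis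
    using approved_offices_remove[OF assms, of w B]
      approved_offices_remove[OF assms, of "w(j := a)" B] by simp
qed

text \<open>The count drops by at most one, and only if \<open>w j \<in> B\<close>; the harmonic
  term lost is then the last one. If the count is 0, the quotient is 0 by convention.\<close>

lemma harm_fun_upd_ge:
  assumes "finite J" "j \<in> J"
  shows "harm (approved_offices J (w(j := a)) B) \<ge>
         harm (approved_offices J w B) - of_bool (w j \<in> B) / real (approved_offices J w B)"
proof -
  let ?u = "approved_offices J w B" and ?u' = "approved_offices J (w(j := a)) B"
  have upd: "?u' + of_bool (w j \<in> B) = ?u + of_bool (a \<in> B)"
    by (rule approved_offices_fun_upd[OF assms])
  show ?thesis
  proof (cases "?u' \<ge> ?u")
    case True
    then have "(harm ?u :: real) \<le> harm ?u'"
      by (rule harm_mono)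
    then show ?thesis
      by (intro order_trans[OF _ \<open>harm ?u \<le> harm ?u'\<close>]) simp
  next
    case False
    then have "?u = Suc ?u'" and "w j \<in> B"
      using upd by (auto simp: of_bool_def split: if_splits)
    then show ?thesis
      by (simp add: harm_Suc inverse_eq_divide)
  qed
qed

text \<open>The new harmonic term is 1/(u+1) for the old count u, and u+1 \<le>
  \<open>l\<close>.\<close>

lemma harm_fun_upd_gain:
  assumes "finite J" "j \<in> J" "w j \<notin> B" "a \<in> B" "approved_offices J w B < l"
  shows "harm (approved_offices J (w(j := a)) B) \<ge> harm (approved_offices J w B) + 1 / real l"
proof -
  have "approved_offices J (w(j := a)) B = Suc (approved_offices J w B)"
    using approved_offices_fun_upd[OF assms(1,2), of w a B] assms(3,4) by simp
  moreover have "1 / real l \<le> 1 / real (Suc (approved_offices J w B))"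
    using assms(5) by (intro divide_left_mono) auto
  ultimately show ?thesis
    by (simp add: harm_Suc inverse_eq_divide)
qed

lemma pav_optimal_group_approves:
  assumes fin: "finite J" "finite N"
    and S: "S \<subseteq> N" "S \<noteq> {}"
    and T: "T \<subseteq> J" "\<And>j. j \<in> T \<Longrightarrow> (\<Inter>i\<in>S. v i) \<inter> A j \<noteq> {}"
    and l: "l > 0" "l * card N \<le> card T * card S"
    and w: "w \<in> Pi\<^sub>E J A"
    and opt: "\<And>w'. w' \<in> Pi\<^sub>E J A \<Longrightarrow> pav_score J N v w' \<le> pav_score J N v w"
  shows "l \<le> approved_offices J w (\<Union>i\<in>S. v i)"
proof (rule ccontr)
  define U where "U = (\<Union>i\<in>S. v i)"
  define D where "D = {j\<in>T. w j \<notin> U}"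
  let ?u = "\<lambda>i. approved_offices J w (v i)"
  assume "\<not> ?thesis"
  then have less: "approved_offices J w U < l"
    by (simp add: U_def)
  have finT: "finite T" and finD: "finite D" and finS: "finite S"
    using T fin S by (auto simp: D_def intro: finite_subset)
  have uS: "?u i < l" if "i \<in> S" for i
  proof -
    have "?u i \<le> approved_offices J w U"
      unfolding approved_offices_def using fin that by (intro card_mono) (auto simp: U_def)
    with less show ?thesis by simp
  qed
  \<comment> \<open>Strict because fewer than \<open>l\<close> offices of \<open>T\<close> have a
    winner in \<open>U\<close>; the final contradiction rests on this.\<close>
  have cardD: "card T < card D + l"
  proof -
    have "card T = card D + card {j\<in>T. w j \<in> U}"
      using finT by (subst card_Un_disjoint[symmetric]) (auto simp: D_def intro: arg_cong[where f=card])
    moreover have "card {j\<in>T. w j \<in> U} \<le> approved_offices J w U"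
      unfolding approved_offices_def using fin T by (intro card_mono) auto
    ultimately show ?thesis using less by simp
  qed
  have swap: "real (card S) / l \<le> (\<Sum>i\<in>N - S. of_bool (w j \<in> v i) / real (?u i))"
    if "j \<in> D" for j
  proof -
    have j: "j \<in> T" "j \<in> J" "w j \<notin> U"
      using that T by (auto simp: D_def)
    obtain a where a: "a \<in> A j" "\<And>i. i \<in> S \<Longrightarrow> a \<in> v i"
      using T(2)[OF j(1)] by auto
    let ?h = "\<lambda>i. harm (approved_offices J (w(j := a)) (v i)) :: real"
    have "w(j := a) \<in> Pi\<^sub>E J A"
      using w a j by (auto simp: PiE_iff extensional_def)
    then have "pav_score J N v (w(j := a)) \<le> pav_score J N v w"
      by (rule opt)
    then have "(\<Sum>i\<in>S. ?h i) + (\<Sum>i\<in>N - S. ?h i)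
        \<le> (\<Sum>i\<in>S. harm (?u i)) + (\<Sum>i\<in>N - S. harm (?u i))"
      unfolding pav_score_def using sum.subset_diff[OF S(1) fin(2)] by (metis add.commute)
    moreover have "(\<Sum>i\<in>S. harm (?u i) + 1 / real l) \<le> (\<Sum>i\<in>S. ?h i)"
      using j a uS fin by (intro sum_mono harm_fun_upd_gain) (auto simp: U_def)
    moreover have "(\<Sum>i\<in>N - S. harm (?u i) - of_bool (w j \<in> v i) / real (?u i))
        \<le> (\<Sum>i\<in>N - S. ?h i)"
      using j fin by (intro sum_mono harm_fun_upd_ge)
    ultimately show ?thesis
      by (simp add: sum.distrib sum_subtractf)
  qed
  have "card D * (real (card S) / l)
      \<le> (\<Sum>j\<in>D. \<Sum>i\<in>N - S. of_bool (w j \<in> v i) / real (?u i))"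
    using sum_mono[OF swap] by simp
  \<comment> \<open>Double counting: regroup the losses by voter, so that each voter outside
    \<open>S\<close> loses at most 1 over all exchanges.\<close>
  also have "\<dots> = (\<Sum>i\<in>N - S. \<Sum>j\<in>D. of_bool (w j \<in> v i) / real (?u i))"
    by (rule sum.swap)
  also have "\<dots> \<le> (\<Sum>i\<in>N - S. 1)"
  proof (rule sum_mono)
    fix i
    have "(\<Sum>j\<in>D. of_bool (w j \<in> v i)) = real (card {j\<in>D. w j \<in> v i})"
      using finD by (simp add: of_bool_def sum.If_cases Int_def)
    also have "\<dots> \<le> real (?u i)"
      unfolding approved_offices_def using fin T by (intro of_nat_mono card_mono) (auto simp: D_def)
    finally show "(\<Sum>j\<in>D. of_bool (w j \<in> v i) / real (?u i)) \<le> 1"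
      by (auto simp: sum_divide_distrib[symmetric] divide_le_eq_1)
  qed
  also have "\<dots> = real (card N - card S)"
    using S finS by (simp add: card_Diff_subset)
  finally have "real (card D * card S) \<le> real (l * (card N - card S))"
    using l by (simp add: field_simps)
  then have "card D * card S \<le> l * (card N - card S)"
    by (simp only: of_nat_le_iff)
  \<comment> \<open>Adding \<open>l * card S\<close> cancels the subtraction, which is exact as
    \<open>S \<subseteq> N\<close>.\<close>
  then have "(card D + l) * card S \<le> l * (card N - card S) + l * card S"
    by (simp add: add_mult_distrib)
  also have "\<dots> = l * card N"
    using card_mono[OF fin(2) S(1)] by (simp flip: add_mult_distrib2)
  also have "\<dots> \<le> card T * card S"
    by (rule l)
  finally show False
    using cardD S finS by (simp add: card_gt_0_iff)
qed

theorem proposition5: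
  fixes A :: "nat \<Rightarrow> 'c set" and v :: "nat \<Rightarrow> 'c set" and k n :: nat
  assumes "election k A n v"
  shows "\<exists>X. office_allocation k A X \<and> partial_PJR k A n v X"
proof -
  have n: "n \<ge> 1" and A: "\<And>j. j \<in> {1..k} \<Longrightarrow> finite (A j) \<and> A j \<noteq> {}"
    and disj: "disjoint_family_on A {1..k}"
    using assms by (auto simp: election_def)
  let ?W = "Pi\<^sub>E {1..k} A" and ?score = "pav_score {1..k} {1..n} v"
  have "finite ?W" "?W \<noteq> {}"
    using A by (auto intro!: finite_PiE simp: PiE_eq_empty_iff)
  then have "Max (?score ` ?W) \<in> ?score ` ?W"
    by (intro Max_in) auto
  then obtain w where w: "w \<in> ?W" and "Max (?score ` ?W) = ?score w"
    by blast
  then have opt: "?score w' \<le> ?score w" if "w' \<in> ?W" for w'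
    using \<open>finite ?W\<close> that by (metis Max_ge finite_imageI imageI)
  \<comment> \<open>Winners of different offices lie in disjoint sets, so counting offices agrees
    with counting winners.\<close>
  have inj: "inj_on w {1..k}"
    using w disj by (force simp: inj_on_def disjoint_family_on_def PiE_iff)
  have card_eq: "card (B \<inter> w ` {1..k}) = approved_offices {1..k} w B" for B
  proof -
    have "B \<inter> w ` {1..k} = w ` {j\<in>{1..k}. w j \<in> B}"
      by auto
    then show ?thesis
      using inj by (auto simp: approved_offices_def intro!: card_image elim: inj_on_subset)
  qed
  have "partial_PJR k A n v (w ` {1..k})"
    unfolding partial_PJR_def
  proof (intro allI impI, elim conjE exE)
    fix S k' T
    assume S: "S \<subseteq> {1..n}" "S \<noteq> {}"
      and T: "T \<subseteq> {1..k}" "k' \<le> card T" "\<forall>j\<in>T. (\<Inter>i\<in>S. v i) \<inter> A j \<noteq> {}"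
      and pos: "\<lfloor>real (card S) / real n * real k'\<rfloor> > 0"
    \<comment> \<open>The floor is positive, so \<open>nat\<close> loses nothing; clearing the
      denominator \<open>n\<close> and using \<open>k' \<le> card T\<close> gives the bound that the
      exchange argument needs.\<close>
    define l where "l = nat \<lfloor>real (card S) / real n * real k'\<rfloor>"
    have "real l \<le> real (card S) / real n * real k'"
      using pos by (simp add: l_def)
    then have "real (l * n) \<le> real (card S * k')"
      using n by (simp add: field_simps)
    then have "l * n \<le> card S * k'"
      by (simp only: of_nat_le_iff)
    also have "\<dots> \<le> card T * card S"
      using T by simp
    finally have "l \<le> approved_offices {1..k} w (\<Union>i\<in>S. v i)"
      using S T pos w opt
      by (intro pav_optimal_group_approves[where A = A and N = "{1..n}" and T = T]) (auto simp: l_def)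
    then show "\<lfloor>real (card S) / real n * real k'\<rfloor> \<le> int (card ((\<Union>i\<in>S. v i) \<inter> w ` {1..k}))"
      unfolding card_eq l_def by linarith
  qed
  moreover have "office_allocation k A (w ` {1..k})"
    using w by (auto simp: office_allocation_def PiE_iff)
  ultimately show ?thesis
    by blast
qed

end
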